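(* Let $V$ be a finite set and $f:2^V\to\mathbb{R}^{\ge0}$ a monotone submodular function. Let $*\notin V$ be a new element and define $f':2^{V\cup\{*\}}\to\mathbb{R}^{\ge0}$ by setting, for every $S\subseteq V$, \[ f'(S)=f(S)\quad\text{and}\quad f'\big((V\setminus S)\cup\{*\}\big)=f(S). \] Then $f'$ is submodular and symmetric.
   Context: A function $g:2^U\to\mathbb{R}^{\ge0}$ is submodular if for all $S\subset T\subset U$ and $x\in U\setminus T$, $g(S\cup\{x\})-g(S)\ge g(T\cup\{x\})-g(T)$; it is monotone if $g(S)\le g(T)$ whenever $S\subseteq T$; it is symmetric if $g(S)=g(U\setminus S)$ for all $S\subseteq U$. *)

theory Defs
  imports Complex_Main "HOL-Library.FuncSet"
begin

text \<open>
  A function \<open>2\<^sup>U \<rightarrow> \<real>\<^sup>\<ge>\<^sup>0\<close> is a function \<open>g :: 'a set \<Rightarrow> real\<close> with \<open>g \<in> Pow U \<rightarrow> {0..}\<close>;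
  its values outside \<open>Pow U\<close> are irrelevant.  Monotonicity is \<open>mono_on (Pow U) g\<close>.
\<close>

definition submodular_on :: "'a set \<Rightarrow> ('a set \<Rightarrow> real) \<Rightarrow> bool" where
  "submodular_on U g \<longleftrightarrow>
     (\<forall>S T x. S \<subseteq> T \<longrightarrow> T \<subseteq> U \<longrightarrow> x \<in> U - T \<longrightarrow>
        g (S \<union> {x}) - g S \<ge> g (T \<union> {x}) - g T)"

definition symmetric_on :: "'a set \<Rightarrow> ('a set \<Rightarrow> real) \<Rightarrow> bool" where
  "symmetric_on U g \<longleftrightarrow> (\<forall>S. S \<subseteq> U \<longrightarrow> g S = g (U - S))"

text \<open>
  \<open>symmetric_extension V z f f'\<close> are the defining equations of the extension \<open>f'\<close> of \<open>f\<close>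
  to the subsets of \<open>V \<union> {z}\<close>.  For \<open>z \<notin> V\<close> they are consistent and determine \<open>f'\<close> on
  \<open>Pow (V \<union> {z})\<close>, as the two lemmas below show.
\<close>

definition symmetric_extension ::
  "'a set \<Rightarrow> 'a \<Rightarrow> ('a set \<Rightarrow> real) \<Rightarrow> ('a set \<Rightarrow> real) \<Rightarrow> bool" where
  "symmetric_extension V z f f' \<longleftrightarrow>
     (\<forall>S. S \<subseteq> V \<longrightarrow> f' S = f S \<and> f' ((V - S) \<union> {z}) = f S)"

lemma symmetric_extension_exists:
  assumes "z \<notin> V"
  shows "\<exists>f'. symmetric_extension V z f f'"
proof -
  have "V - insert z (V - S) = S" if "S \<subseteq> V" for S
    using assms that by blast
  then have "symmetric_extension V z f (\<lambda>T. if z \<in> T then f (V - T) else f T)"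
    using assms by (auto simp: symmetric_extension_def)
  then show ?thesis by blast
qed

lemma symmetric_extension_unique:
  assumes "z \<notin> V" "symmetric_extension V z f f'" "symmetric_extension V z f f''"
    and "T \<subseteq> V \<union> {z}"
  shows "f' T = f'' T"
proof (cases "z \<in> T")
  case True
  then have "(V - (V - T)) \<union> {z} = T"
    using assms(4) by blast
  then show ?thesis
    using assms(2,3) unfolding symmetric_extension_def by (metis Diff_subset)
next
  case False
  then have "T \<subseteq> V"
    using assms(4) by blast
  then show ?thesis
    using assms(2,3) by (simp add: symmetric_extension_def)
qed

end

theory Submission
  imports Defs
begin

text \<open>
  Submodularity of \<open>f'\<close> compares the marginal values of \<open>x\<close> at \<open>S \<subseteq> T\<close>.  If \<open>T\<close> avoids the new
  element \<open>z\<close>, or \<open>S\<close> contains it, this is submodularity of \<open>f\<close>, applied in the second case to the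
  complements.  If \<open>z \<in> T - S\<close>, monotonicity makes the marginal value nonnegative at \<open>S\<close> and
  nonpositive at \<open>T\<close>, where adding \<open>x\<close> shrinks the complement.  If \<open>x = z\<close>, monotonicity is applied
  to \<open>S \<subseteq> T\<close> and to their complements.
\<close>

text \<open>Solves the defining equations for the value at a given argument \<open>T\<close>: if
  \<open>z\<close> lies in \<open>T\<close>, the second equation is used at \<open>V - T\<close>,
  whose complement in \<open>V\<close>, together with \<open>z\<close>, is \<open>T\<close>
  again.\<close>

lemma symmetric_extension_eq:
  assumes "symmetric_extension V z f f'" "T \<subseteq> V \<union> {z}"
  shows "z \<notin> T \<Longrightarrow> f' T = f T" "z \<in> T \<Longrightarrow> f' T = f (V - T)"
proof -
  show "f' T = f T" if "z \<notin> T"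
    using assms that by (auto simp: symmetric_extension_def)
  show "f' T = f (V - T)" if "z \<in> T"
  proof -
    have "(V - (V - T)) \<union> {z} = T"
      using assms(2) that by blast
    then show ?thesis
      using assms(1) unfolding symmetric_extension_def by (metis Diff_subset)
  qed
qed

theorem theorem1p5:
  fixes V :: "'a set" and z :: 'a and f f' :: "'a set \<Rightarrow> real"
  assumes "finite V"
    and "f \<in> Pow V \<rightarrow> {0..}"
    and "mono_on (Pow V) f"
    and "submodular_on V f"
    and "z \<notin> V"
    and "symmetric_extension V z f f'"
  shows "f' \<in> Pow (V \<union> {z}) \<rightarrow> {0..} \<and>
         submodular_on (V \<union> {z}) f' \<and> symmetric_on (V \<union> {z}) f'"
proof (intro conjI)
  note ext = symmetric_extension_eq[OF assms(6)]
  have mono: "f A \<le> f B" if "A \<subseteq> B" "B \<subseteq> V" for A B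
    using that by (intro mono_onD[OF assms(3)]) auto
  have submod: "f (B \<union> {x}) - f B \<le> f (A \<union> {x}) - f A"
    if "A \<subseteq> B" "B \<subseteq> V" "x \<in> V - B" for A B x
    using assms(4) that unfolding submodular_on_def by blast
  show "f' \<in> Pow (V \<union> {z}) \<rightarrow> {0..}"
  proof
    fix T assume T: "T \<in> Pow (V \<union> {z})"
    show "f' T \<in> {0..}"
    proof (cases "z \<in> T")
      case True
      have "f (V - T) \<in> {0..}"
        using assms(2) by (rule funcset_mem) blast
      then show ?thesis
        using ext(2) T True by simp
    next
      case False
      have "f T \<in> {0..}"
        using assms(2) by (rule funcset_mem) (use T False in blast)
      then show ?thesis
        using ext(1) T False by simp
    qed
  qed
  show "symmetric_on (V \<union> {z}) f'"
    unfolding symmetric_on_def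
  proof (intro allI impI)
    fix S assume S: "S \<subseteq> V \<union> {z}"
    show "f' S = f' (V \<union> {z} - S)"
    proof (cases "z \<in> S")
      case True
      then have "V \<union> {z} - S = V - S" by blast
      then show ?thesis
        using ext(1)[of "V - S"] ext(2)[OF S True] True by (simp add: subset_insertI2)
    next
      case False
      \<comment> \<open>The complement of \<open>S\<close> contains \<open>z\<close>, so
        \<open>f'\<close> evaluates \<open>f\<close> at the complement of that set within
        \<open>V\<close>, which is \<open>S\<close> again.\<close>
      then have "V - (V \<union> {z} - S) = S"
        using S assms(5) by blast
      then show ?thesis
        using ext(1)[OF S False] ext(2)[of "V \<union> {z} - S"] False by auto
    qed
  qed
  show "submodular_on (V \<union> {z}) f'"
    unfolding submodular_on_def
  proof (intro allI impI)
    fix S T x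
    assume ST: "S \<subseteq> T" and T: "T \<subseteq> V \<union> {z}" and x: "x \<in> V \<union> {z} - T"
    have S: "S \<subseteq> V \<union> {z}" and Sx: "S \<union> {x} \<subseteq> V \<union> {z}" and Tx: "T \<union> {x} \<subseteq> V \<union> {z}"
      using ST T x by auto
    \<comment> \<open>Knowing which of the four sets contain \<open>z\<close> turns every value of
      \<open>f'\<close> in the inequality into a value of \<open>f\<close>.\<close>
    note eqs = ext[OF S] ext[OF T] ext[OF Sx] ext[OF Tx]
    consider "x = z" | "x \<noteq> z" "z \<notin> T" | "x \<noteq> z" "z \<in> S" | "x \<noteq> z" "z \<in> T" "z \<notin> S"
      by blast
    then show "f' (T \<union> {x}) - f' T \<le> f' (S \<union> {x}) - f' S"
    proof cases
      case 1
      then have z: "z \<notin> T" "z \<notin> S"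
        using x ST by auto
      \<comment> \<open>The marginal value of \<open>z\<close> at \<open>A\<close> is
        \<open>f (V - (A \<union> {z})) - f A\<close>, which can only decrease as \<open>A\<close>
        grows.\<close>
      have "f S \<le> f T" "f (V - (T \<union> {z})) \<le> f (V - (S \<union> {z}))"
        using ST T z by (auto intro!: mono)
      then show ?thesis
        using eqs z 1 by simp
    next
      case 2
      then have "z \<notin> S"
        using ST by blast
      moreover have "f (T \<union> {x}) - f T \<le> f (S \<union> {x}) - f S"
        using ST T x 2 by (intro submod) auto
      ultimately show ?thesis
        using eqs 2 by simp
    next
      case 3
      then have "z \<in> T"
        using ST by blast
      \<comment> \<open>The marginal value of \<open>f'\<close> at \<open>T\<close> is minus that of
        \<open>f\<close> at \<open>V - (T \<union> {x})\<close>, and likewise for \<open>S\<close>.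
        Complements reverse the inclusion and the sign reverses the inequality, so the two reversals
        cancel.\<close>
      have "(V - (T \<union> {x})) \<union> {x} = V - T" "(V - (S \<union> {x})) \<union> {x} = V - S"
        using ST x 3 by auto
      moreover have "f ((V - (S \<union> {x})) \<union> {x}) - f (V - (S \<union> {x}))
          \<le> f ((V - (T \<union> {x})) \<union> {x}) - f (V - (T \<union> {x}))"
        using ST x 3 by (intro submod) auto
      ultimately show ?thesis
        using eqs 3 \<open>z \<in> T\<close> by simp
    next
      case 4
      have "f S \<le> f (S \<union> {x})" "f (V - (T \<union> {x})) \<le> f (V - T)"
        using S x 4 by (auto intro!: mono)
      then show ?thesis
        using eqs 4 by simp
    qed
  qed
qed

end
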